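(* Let $\overline{A}(n,x)=\sum_{b=2}^{\lfloor x\rfloor}\frac{2}{b-1}S_b(n)\log b$. Then for all integers $n\ge 2$ and real $\alpha\in\left[\frac1{\sqrt n},1\right]$, $$\overline{A}(n,\alpha n)=f_{\overline{A}}(\alpha)\,n^2\log n+g_{\overline{A}}(\alpha)\,n^2+O\left(n^{3/2}\log n\right),$$ in which: (a) $f_{\overline{A}}$ is the function with $f_{\overline{A}}(0)=0$ and defined for all $\alpha>0$ by $$f_{\overline{A}}(\alpha)=\left(\frac32-\gamma\right)+\left(H_{\lfloor\frac1\alpha\rfloor}-\log\frac1\alpha\right)+\frac12\alpha^2\left\lfloor\frac1\alpha\right\rfloor^2+\frac12\alpha^2\left\lfloor\frac1\alpha\right\rfloor-2\alpha\left\lfloor\frac1\alpha\right\rfloor;$$ (b) $g_{\overline{A}}$ is the function with $g_{\overline{A}}(0)=0$ and defined for all $\alpha>0$ by $$\begin{aligned}g_{\overline{A}}(\alpha)=&\left(\frac32\gamma+\gamma_1-\frac74\right)-\frac32\left(H_{\lfloor\frac1\alpha\rfloor}-\log\frac1\alpha\right)-\left(J_{\lfloor\frac1\alpha\rfloor}-\frac12\left(\log\frac1\alpha\right)^2\right)\\&+\left(\log\frac1\alpha\right)\left(-\frac32-\frac12\alpha^2\left\lfloor\frac1\alpha\right\rfloor\left\lfloor\frac1\alpha+1\right\rfloor+2\alpha\left\lfloor\frac1\alpha\right\rfloor\right)-\frac14\alpha^2\left\lfloor\frac1\alpha\right\rfloor\left\lfloor\frac1\alpha+1\right\rfloor+2\alpha\left\lfloor\frac1\alpha\right\rfloor.\end{aligned}$$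 Moreover, for all integers $n\ge 2$ and real $\alpha\in\left[\frac1n,\frac1{\sqrt n}\right]$, $$\overline{A}(n,\alpha n)=O\left(n^{3/2}\log n\right).$$
   Context: For integers $b\ge 2$ and $n\ge 1$, $d_b(n)$ denotes the sum of the base-$b$ digits of $n$, and $S_b(n):=\sum_{j=1}^{n-1}d_b(j)$. $H_m=\sum_{j=1}^m\frac1j$ and $J_m=\sum_{j=1}^m\frac{\log j}{j}$. $\gamma$ is Euler's constant and $\gamma_1=\lim_{n\to\infty}\left(\sum_{k=1}^n\frac{\log k}{k}-\frac{(\log n)^2}{2}\right)$ is the first Stieltjes constant. The constants implied by the $O$-notation are absolute (independent of $n$ and $\alpha$). *)

theory Defs
  imports "HOL-Analysis.Analysis"
begin

text \<open>
  Sum of the base-\<open>b\<close> digits of \<open>n\<close>. Only \<open>b \<ge> 2\<close> is meaningful; the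
  value for \<open>b < 2\<close> is a dummy that makes the recursion terminate.
\<close>

fun digit_sum :: "nat \<Rightarrow> nat \<Rightarrow> nat" where
  "digit_sum b n = (if b < 2 \<or> n = 0 then 0 else n mod b + digit_sum b (n div b))"

declare digit_sum.simps [simp del]

definition S_sum :: "nat \<Rightarrow> nat \<Rightarrow> nat" where
  "S_sum b n = (\<Sum>j=1..<n. digit_sum b j)"

definition A_bar :: "nat \<Rightarrow> real \<Rightarrow> real" where
  "A_bar n x = (\<Sum>b = 2..nat \<lfloor>x\<rfloor>. 2 / (real b - 1) * real (S_sum b n) * ln (real b))"

definition J_sum :: "nat \<Rightarrow> real" where
  "J_sum m = (\<Sum>j=1..m. ln (real j) / real j)"

definition stieltjes_1 :: real where
  "stieltjes_1 = lim (\<lambda>n. (\<Sum>k=1..n. ln (real k) / real k) - (ln (real n))\<^sup>2 / 2)"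

text \<open>The two functions below are only of interest for \<open>\<alpha> \<ge> 0\<close>.\<close>

definition f_A_bar :: "real \<Rightarrow> real" where
  "f_A_bar \<alpha> = (if \<alpha> = 0 then 0 else
     (3/2 - euler_mascheroni)
     + (harm (nat \<lfloor>1/\<alpha>\<rfloor>) - ln (1/\<alpha>))
     + 1/2 * \<alpha>\<^sup>2 * (of_int \<lfloor>1/\<alpha>\<rfloor>)\<^sup>2
     + 1/2 * \<alpha>\<^sup>2 * of_int \<lfloor>1/\<alpha>\<rfloor>
     - 2 * \<alpha> * of_int \<lfloor>1/\<alpha>\<rfloor>)"

definition g_A_bar :: "real \<Rightarrow> real" where
  "g_A_bar \<alpha> = (if \<alpha> = 0 then 0 else
     (3/2 * euler_mascheroni + stieltjes_1 - 7/4)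
     - 3/2 * (harm (nat \<lfloor>1/\<alpha>\<rfloor>) - ln (1/\<alpha>))
     - (J_sum (nat \<lfloor>1/\<alpha>\<rfloor>) - 1/2 * (ln (1/\<alpha>))\<^sup>2)
     + ln (1/\<alpha>) * (- 3/2 - 1/2 * \<alpha>\<^sup>2 * of_int \<lfloor>1/\<alpha>\<rfloor> * of_int \<lfloor>1/\<alpha> + 1\<rfloor>
                     + 2 * \<alpha> * of_int \<lfloor>1/\<alpha>\<rfloor>)
     - 1/4 * \<alpha>\<^sup>2 * of_int \<lfloor>1/\<alpha>\<rfloor> * of_int \<lfloor>1/\<alpha> + 1\<rfloor>
     + 2 * \<alpha> * of_int \<lfloor>1/\<alpha>\<rfloor>)"

end

theory Submission
  imports Defs
begin

text \<open>
  For \<open>b\<^sup>2 \<ge> n\<close> every \<open>j < n\<close> has at most two digits in base \<open>b\<close>, so \<open>S_sum b n\<close> is explicit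
  in terms of \<open>q = n div b\<close>, and up to a telescoping error the \<open>b\<close>-th summand equals
  \<open>ln b * \<phi> b\<close> with \<open>\<phi> x = n\<^sup>2 / x - 2 n q + q (q + 1) x\<close>, \<open>q = \<lfloor>n / x\<rfloor>\<close>.
  The claimed main term \<open>G x\<close> at \<open>x = \<alpha> n\<close> is a \<open>C\<^sup>1\<close> function of \<open>x\<close> (the pieces between the points
  \<open>n / k\<close> fit together) with \<open>G' x = ln x * \<phi> x\<close>. Since \<open>\<phi>\<close> takes values in \<open>[0, n]\<close> and
  changes by at most \<open>2 n / x\<close> on unit intervals beyond \<open>\<surd>n\<close>, the mean value theorem shows that
  \<open>G b - G (b - 1)\<close> differs from the \<open>b\<close>-th summand by \<open>O(\<surd>n ln n)\<close> plus that telescoping error.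
  The bases below \<open>\<surd>n\<close> contribute \<open>O(n ln n)\<close> each, and
  \<open>G x = O(n x ln n)\<close>, because \<open>f(1/y)\<close> and \<open>g(1/y)\<close> tend to \<open>0\<close> as \<open>y \<rightarrow> \<infinity>\<close> and their
  derivatives are at most \<open>1 / y\<^sup>2\<close> and \<open>ln y / y\<^sup>2\<close> in absolute value.
\<close>

section \<open>Differentiability of functions glued at the integers\<close>

text \<open>Away from the integers only one piece is seen locally. At an integer the left and right
  difference quotients belong to neighbouring pieces; \<open>F_match\<close> makes them share the
  value at the point and \<open>D_match\<close> gives them the same limit.\<close>

lemma has_real_derivative_floor_pieces:
  fixes F D :: "nat \<Rightarrow> real \<Rightarrow> real"
  assumes deriv: "\<And>q x. x > 0 \<Longrightarrow> (F q has_real_derivative D q x) (at x)"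
    and F_match: "\<And>q. F q (real (Suc q)) = F (Suc q) (real (Suc q))"
    and D_match: "\<And>q. D q (real (Suc q)) = D (Suc q) (real (Suc q))"
    and "x > 0"
  shows "((\<lambda>x. F (nat \<lfloor>x\<rfloor>) x) has_real_derivative D (nat \<lfloor>x\<rfloor>) x) (at x)"
proof (cases "x \<in> \<int>")
  case False
  define q where "q = nat \<lfloor>x\<rfloor>"
  have "x \<noteq> real q" using False by auto
  then have "real q < x" "x < real q + 1"
    using \<open>x > 0\<close> unfolding q_def by linarith+
  moreover have "F q y = F (nat \<lfloor>y\<rfloor>) y" if "y \<in> {real q<..<real q + 1}" for y
  proof -
    have "\<lfloor>y\<rfloor> = int q" using that by (intro floor_unique) auto
    then show ?thesis by simp
  qed
  ultimately show ?thesis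
    using has_field_derivative_transform_within_open[OF deriv[OF \<open>x > 0\<close>, of q],
        of "{real q<..<real q + 1}" "\<lambda>x. F (nat \<lfloor>x\<rfloor>) x"]
    unfolding q_def by auto
next
  case True
  then obtain q where x: "x = real (Suc q)"
    using \<open>x > 0\<close> by (metis Ints_cases gr0_implies_Suc of_int_0_less_iff of_int_of_nat_eq
        zero_less_imp_eq_int)
  let ?G = "\<lambda>x. F (nat \<lfloor>x\<rfloor>) x"
  have Gx: "?G x = F (Suc q) x" using x by (simp add: nat_add_distrib)
  have fl: "nat \<lfloor>x\<rfloor> = Suc q" using x by (simp add: nat_add_distrib)
  \<comment> \<open>Just left of \<open>x\<close> the floor is \<open>q\<close>, although at
    \<open>x\<close> it is already \<open>Suc q\<close>; this is the side on which both matching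
    conditions enter.\<close>
  have left: "((\<lambda>y. (?G y - ?G x) / (y - x)) \<longlongrightarrow> D (Suc q) x) (at_left x)"
  proof -
    have "((\<lambda>y. (F q y - F q x) / (y - x)) \<longlongrightarrow> D q x) (at_left x)"
      using deriv[OF \<open>x > 0\<close>, of q] unfolding has_field_derivative_iff
      by (rule filterlim_mono) (auto simp: at_le)
    moreover have "\<forall>\<^sub>F y in at_left x. (F q y - F q x) / (y - x) = (?G y - ?G x) / (y - x)"
    proof (rule eventually_mono[OF eventually_at_left_real[of "real q" x]])
      fix y assume y: "y \<in> {real q<..<x}"
      have "\<lfloor>y\<rfloor> = int q" using y x by (intro floor_unique) auto
      then show "(F q y - F q x) / (y - x) = (?G y - ?G x) / (y - x)"
        using Gx F_match[of q] x by simp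
    qed (use x in auto)
    ultimately have "((\<lambda>y. (?G y - ?G x) / (y - x)) \<longlongrightarrow> D q x) (at_left x)"
      by (rule Lim_transform_eventually)
    then show ?thesis using D_match[of q] by (simp only: x)
  qed
  have right: "((\<lambda>y. (?G y - ?G x) / (y - x)) \<longlongrightarrow> D (Suc q) x) (at_right x)"
  proof -
    have "((\<lambda>y. (F (Suc q) y - F (Suc q) x) / (y - x)) \<longlongrightarrow> D (Suc q) x) (at_right x)"
      using deriv[OF \<open>x > 0\<close>, of "Suc q"] unfolding has_field_derivative_iff
      by (rule filterlim_mono) (auto simp: at_le)
    moreover have "\<forall>\<^sub>F y in at_right x. (F (Suc q) y - F (Suc q) x) / (y - x) = (?G y - ?G x) / (y - x)"
    proof (rule eventually_mono[OF eventually_at_right_real[of x "x + 1"]])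
      fix y assume y: "y \<in> {x<..<x + 1}"
      have "\<lfloor>y\<rfloor> = int (Suc q)" using y x by (intro floor_unique) auto
      then show "(F (Suc q) y - F (Suc q) x) / (y - x) = (?G y - ?G x) / (y - x)"
        using Gx by (simp add: nat_add_distrib)
    qed auto
    ultimately show ?thesis by (rule Lim_transform_eventually)
  qed
  show ?thesis
    using filterlim_split_at_real[OF left right]
    unfolding has_field_derivative_iff by (simp add: fl)
qed

section \<open>The main-term functions in the variable \<open>y = 1 / \<alpha>\<close>\<close>

text \<open>Here and in the next two definitions \<open>q\<close> stands for the floor of
  \<open>y\<close> but is kept free, so that each piece is smooth for all \<open>y > 0\<close>.
  \<open>kernel_piece\<close> is minus the derivative of \<open>f_piece\<close>, and
  \<open>ln y\<close> times it is the derivative of \<open>g_piece\<close>.\<close>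

definition kernel_piece :: "nat \<Rightarrow> real \<Rightarrow> real" where
  "kernel_piece q y = 1 / y - 2 * real q / y\<^sup>2 + real q * (real q + 1) / y ^ 3"

definition f_piece :: "nat \<Rightarrow> real \<Rightarrow> real" where
  "f_piece q y = 3/2 - euler_mascheroni + (harm q - ln y)
     + real q * (real q + 1) / (2 * y\<^sup>2) - 2 * real q / y"

definition g_piece :: "nat \<Rightarrow> real \<Rightarrow> real" where
  "g_piece q y = (3/2 * euler_mascheroni + stieltjes_1 - 7/4)
     - 3/2 * (harm q - ln y) - (J_sum q - 1/2 * (ln y)\<^sup>2)
     + ln y * (- 3/2 - real q * (real q + 1) / (2 * y\<^sup>2) + 2 * real q / y)
     - real q * (real q + 1) / (4 * y\<^sup>2) + 2 * real q / y"

definition kernel :: "real \<Rightarrow> real" where "kernel y = kernel_piece (nat \<lfloor>y\<rfloor>) y"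
definition f_inv :: "real \<Rightarrow> real" where "f_inv y = f_piece (nat \<lfloor>y\<rfloor>) y"
definition g_inv :: "real \<Rightarrow> real" where "g_inv y = g_piece (nat \<lfloor>y\<rfloor>) y"

lemma f_A_bar_eq:
  assumes "\<alpha> > 0" shows "f_A_bar \<alpha> = f_inv (1 / \<alpha>)"
proof -
  define q where "q = nat \<lfloor>1 / \<alpha>\<rfloor>"
  have "real_of_int \<lfloor>1 / \<alpha>\<rfloor> = real q"
    using assms unfolding q_def by simp
  then show ?thesis
    using assms unfolding f_A_bar_def f_inv_def f_piece_def q_def[symmetric]
    by (simp add: power_divide) (simp add: algebra_simps power2_eq_square)
qed

lemma g_A_bar_eq:
  assumes "\<alpha> > 0" shows "g_A_bar \<alpha> = g_inv (1 / \<alpha>)"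
proof -
  define q where "q = nat \<lfloor>1 / \<alpha>\<rfloor>"
  have q: "real_of_int \<lfloor>1 / \<alpha>\<rfloor> = real q"
    using assms unfolding q_def by simp
  have q1: "real_of_int \<lfloor>1 / \<alpha> + 1\<rfloor> = real q + 1"
    using q by simp
  then show ?thesis
    using assms unfolding g_A_bar_def g_inv_def g_piece_def q_def[symmetric] q q1
    by (simp add: power_divide) (simp add: algebra_simps)
qed

text \<open>At \<open>y = q + 1\<close> the jump \<open>1 / (q + 1)\<close> of the harmonic sum
  cancels the jump \<open>- 1 / (q + 1)\<close> of the two rational terms; the two jumps inside the
  kernel cancel as well.\<close>

lemma f_inv_deriv:
  assumes "y > 0" shows "(f_inv has_real_derivative - kernel y) (at y)"
proof -
  have d: "(f_piece q has_real_derivative - kernel_piece q x) (at x)" if "x > 0" for q x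
    unfolding f_piece_def kernel_piece_def using that
    by (auto intro!: derivative_eq_intros simp: field_simps eval_nat_numeral)
  have "f_piece q (real (Suc q)) = f_piece (Suc q) (real (Suc q))" for q
    unfolding f_piece_def by (simp add: harm_Suc divide_simps) (simp add: algebra_simps power2_eq_square)
  moreover have "kernel_piece q (real (Suc q)) = kernel_piece (Suc q) (real (Suc q))" for q
    unfolding kernel_piece_def by (simp add: divide_simps) (simp add: algebra_simps eval_nat_numeral)
  ultimately show ?thesis
    using has_real_derivative_floor_pieces[of f_piece "\<lambda>q x. - kernel_piece q x" y] d assms
    unfolding f_inv_def kernel_def by auto
qed

text \<open>At \<open>y = m = q + 1\<close> the jump \<open>- ln m / m\<close> from
  \<open>J_sum\<close> cancels the jump of the terms carrying the factor \<open>ln y\<close>; the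
  remaining jumps are \<open>- 3/2\<close>, \<open>- 1/2\<close> and \<open>2\<close>, each divided
  by \<open>m\<close>.\<close>

lemma g_inv_deriv:
  assumes "y > 0" shows "(g_inv has_real_derivative ln y * kernel y) (at y)"
proof -
  have d: "(g_piece q has_real_derivative ln x * kernel_piece q x) (at x)" if "x > 0" for q x
    unfolding g_piece_def kernel_piece_def using that
    by (auto intro!: derivative_eq_intros simp: field_simps eval_nat_numeral)
  have "g_piece q (real (Suc q)) = g_piece (Suc q) (real (Suc q))" for q
  proof -
    define L where "L = ln (real (Suc q))"
    have J: "J_sum (Suc q) = J_sum q + L / real (Suc q)" unfolding J_sum_def L_def by simp
    define m where "m = real (Suc q)"
    have m: "m > 0" "real q = m - 1" unfolding m_def by auto
    show ?thesis
      unfolding g_piece_def J harm_Suc L_def[symmetric] unfolding m_def[symmetric] m(2) using m(1)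
      by (simp add: field_simps power2_eq_square)
  qed
  moreover have "kernel_piece q (real (Suc q)) = kernel_piece (Suc q) (real (Suc q))" for q
    unfolding kernel_piece_def by (simp add: divide_simps) (simp add: algebra_simps eval_nat_numeral)
  ultimately show ?thesis
    using has_real_derivative_floor_pieces[of g_piece "\<lambda>q x. ln x * kernel_piece q x" y] d assms
    unfolding g_inv_def kernel_def by auto
qed

lemma kernel_bounds:
  assumes "y > 0" shows "0 \<le> kernel y" "kernel y \<le> 1 / y\<^sup>2"
proof -
  define q where "q = real (nat \<lfloor>y\<rfloor>)"
  have q: "0 \<le> q" "q \<le> y" "y \<le> q + 1" using assms unfolding q_def by linarith+
  \<comment> \<open>The square is completed: the numerator
    \<open>y\<^sup>2 - 2 q y + q (q + 1)\<close> is a sum of nonnegative terms, and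
    \<open>0 \<le> y - q \<le> 1\<close> bounds it by \<open>y\<close>.\<close>
  have k: "kernel y = ((y - q)\<^sup>2 + q) / y ^ 3"
    using assms unfolding kernel_def kernel_piece_def q_def[symmetric]
    by (simp add: field_simps eval_nat_numeral)
  show "0 \<le> kernel y" unfolding k using q assms by simp
  have "(y - q) * (y - q) \<le> (y - q) * 1" using q by (intro mult_left_mono) auto
  then have "(y - q)\<^sup>2 + q \<le> y" by (simp add: power2_eq_square)
  then have "((y - q)\<^sup>2 + q) / y ^ 3 \<le> y / y ^ 3" using assms by (intro divide_right_mono) auto
  also have "\<dots> = 1 / y\<^sup>2" using assms by (simp add: eval_nat_numeral)
  finally show "kernel y \<le> 1 / y\<^sup>2" unfolding k .
qed

section \<open>Monotonicity\<close>

lemma f_inv_antimono: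
  assumes "0 < x" "x \<le> y" shows "f_inv y \<le> f_inv x"
proof (rule DERIV_nonpos_imp_nonincreasing[OF assms(2)])
  fix t assume "x \<le> t"
  then have "t > 0" using assms by simp
  then show "\<exists>z. (f_inv has_real_derivative z) (at t) \<and> z \<le> 0"
    using f_inv_deriv kernel_bounds(1) by (metis neg_le_0_iff_le)
qed

lemma f_inv_minus_mono:
  assumes "0 < x" "x \<le> y" shows "f_inv x - 1 / x \<le> f_inv y - 1 / y"
proof (rule DERIV_nonneg_imp_nondecreasing[OF assms(2)])
  fix t assume "x \<le> t"
  then have t: "t > 0" using assms by simp
  show "\<exists>z. ((\<lambda>x. f_inv x - 1 / x) has_real_derivative z) (at t) \<and> 0 \<le> z"
    using kernel_bounds[OF t] t
    by (intro exI[of _ "- kernel t + 1 / t\<^sup>2"])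
       (auto intro!: derivative_eq_intros f_inv_deriv simp: power2_eq_square)
qed

lemma g_inv_mono:
  assumes "1 \<le> x" "x \<le> y" shows "g_inv x \<le> g_inv y"
proof (rule DERIV_nonneg_imp_nondecreasing[OF assms(2)])
  fix t assume "x \<le> t"
  then have t: "t \<ge> 1" using assms by simp
  show "\<exists>z. (g_inv has_real_derivative z) (at t) \<and> 0 \<le> z"
    using kernel_bounds[of t] t by (intro exI[of _ "ln t * kernel t"]) (auto intro!: g_inv_deriv)
qed

text \<open>\<open>(1 + ln y) / y\<close> has derivative \<open>- ln y / y\<^sup>2\<close>, which
  outweighs \<open>ln y * kernel y\<close> by the upper bound on the kernel.\<close>

lemma g_inv_plus_antimono:
  assumes "1 \<le> x" "x \<le> y" shows "g_inv y + (1 + ln y) / y \<le> g_inv x + (1 + ln x) / x"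
proof (rule DERIV_nonpos_imp_nonincreasing[OF assms(2)])
  fix t assume "x \<le> t"
  then have t: "t \<ge> 1" using assms by simp
  have "((\<lambda>x. g_inv x + (1 + ln x) / x) has_real_derivative
      ln t * kernel t - ln t * (1 / t\<^sup>2)) (at t)"
    using t by (auto intro!: derivative_eq_intros g_inv_deriv simp: field_simps power2_eq_square)
  moreover have "ln t * kernel t \<le> ln t * (1 / t\<^sup>2)"
    using kernel_bounds[of t] t by (intro mult_left_mono) auto
  ultimately show "\<exists>z. ((\<lambda>x. g_inv x + (1 + ln x) / x) has_real_derivative z) (at t) \<and> z \<le> 0"
    by (intro exI[of _ "ln t * kernel t - ln t * (1 / t\<^sup>2)"]) auto
qed

section \<open>Limits at infinity and the first Stieltjes constant\<close>

lemma f_inv_of_nat_tendsto: "(\<lambda>m. f_inv (real m)) \<longlonglongrightarrow> 0"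
proof -
  \<comment> \<open>At an integer \<open>m\<close> the rational terms are
    \<open>1/2 + 1 / (2 m) - 2\<close>, so the constant \<open>3/2\<close> cancels and only Euler's
    limit and \<open>1 / (2 m)\<close> remain.\<close>
  have "(\<lambda>m. (harm m - ln (real m) - euler_mascheroni) + inverse (real m) / 2)
      \<longlonglongrightarrow> (euler_mascheroni - euler_mascheroni) + 0 / 2"
    by (intro tendsto_intros euler_mascheroni_LIMSEQ lim_inverse_n) auto
  moreover have "\<forall>\<^sub>F m in sequentially.
      (harm m - ln (real m) - euler_mascheroni) + inverse (real m) / 2 = f_inv (real m)"
    using eventually_gt_at_top[of 0]
    by eventually_elim (simp add: f_inv_def f_piece_def field_simps power2_eq_square)
  ultimately show ?thesis by (simp add: tendsto_cong)
qed

text \<open>At an integer the constants \<open>- 7/4 - 1/4 + 2\<close> cancel, and so does the main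
  part \<open>- 3/2 - 1/2 + 2\<close> of the factor of \<open>ln m\<close>. This isolates the
  Stieltjes sequence from a bracket that tends to \<open>0\<close>.\<close>

lemma g_inv_of_nat:
  assumes "m > 0"
  shows "g_inv (real m) = stieltjes_1 - (J_sum m - (ln (real m))\<^sup>2 / 2)
    + (3/2 * (euler_mascheroni - (harm m - ln (real m)))
    - inverse (real m) / 4 - (ln (real m) / real m) / 2)"
proof -
  define L J h where "L = ln (real m)" and "J = J_sum m" and "h = (harm m :: real)"
  have "nat \<lfloor>real m\<rfloor> = m" by simp
  then show ?thesis
    using assms unfolding g_inv_def g_piece_def L_def[symmetric] J_def[symmetric]
    by (simp add: L_def[symmetric] J_def[symmetric] h_def[symmetric] divide_simps)
       (simp add: algebra_simps power2_eq_square)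
qed

lemma g_inv_of_nat_aux_tendsto:
  "(\<lambda>m. 3/2 * (euler_mascheroni - (harm m - ln (real m)))
    - inverse (real m) / 4 - (ln (real m) / real m) / 2) \<longlonglongrightarrow> (0::real)"
proof -
  have "(\<lambda>m. 3/2 * (euler_mascheroni - (harm m - ln (real m)))
    - inverse (real m) / 4 - (ln (real m) / real m) / 2)
    \<longlonglongrightarrow> 3/2 * (euler_mascheroni - euler_mascheroni) - 0 / 4 - (0::real) / 2"
    by (intro tendsto_intros euler_mascheroni_LIMSEQ lim_inverse_n lim_ln_over_n) auto
  then show ?thesis by simp
qed

text \<open>
  \<open>stieltjes_1\<close> is defined by \<open>lim\<close>, so convergence must be shown; up to null sequences the
  sequence is \<open>stieltjes_1 - g_inv m\<close>, and \<open>g_inv\<close> is monotone and bounded.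
\<close>

lemma stieltjes_1_LIMSEQ: "(\<lambda>m. J_sum m - (ln (real m))\<^sup>2 / 2) \<longlonglongrightarrow> stieltjes_1"
proof -
  have "convergent (\<lambda>m. g_inv (real (Suc m)))"
  proof (rule Bseq_monoseq_convergent)
    show "monoseq (\<lambda>m. g_inv (real (Suc m)))"
      by (intro incseq_imp_monoseq incseq_SucI g_inv_mono) auto
    show "Bseq (\<lambda>m. g_inv (real (Suc m)))"
    proof (rule BseqI')
      fix m
      \<comment> \<open>The correction \<open>(1 + ln y) / y\<close> is nonnegative at
        \<open>y = m + 1\<close> and equals \<open>1\<close> at \<open>y = 1\<close>.\<close>
      have "g_inv (real (Suc m)) \<le> g_inv 1 + 1"
        using g_inv_plus_antimono[of 1 "real (Suc m)"]
        by (smt (verit) divide_nonneg_pos ln_ge_zero ln_one of_nat_0_less_iff of_nat_1 of_nat_mono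
            One_nat_def Suc_le_mono div_by_1 le0 zero_less_Suc)
      moreover have "g_inv 1 \<le> g_inv (real (Suc m))" by (rule g_inv_mono) auto
      ultimately show "norm (g_inv (real (Suc m))) \<le> \<bar>g_inv 1\<bar> + 1" by auto
    qed
  qed
  then obtain l where "(\<lambda>m. g_inv (real m)) \<longlonglongrightarrow> l"
    unfolding convergent_def filterlim_sequentially_Suc[of "\<lambda>m. g_inv (real m)"] by blast
  \<comment> \<open>There is no circularity: \<open>stieltjes_1\<close> is so far just a real
    constant contained in \<open>g_inv\<close>, and it cancels when \<open>g_inv_of_nat\<close> is
    solved for the Stieltjes sequence.\<close>
  from tendsto_add[OF tendsto_const tendsto_diff[OF g_inv_of_nat_aux_tendsto this]]
  have "(\<lambda>m. stieltjes_1 + ((3/2 * (euler_mascheroni - (harm m - ln (real m)))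
    - inverse (real m) / 4 - (ln (real m) / real m) / 2) - g_inv (real m)))
    \<longlonglongrightarrow> stieltjes_1 + (0 - l)" .
  moreover have "\<forall>\<^sub>F m in sequentially. stieltjes_1 +
      ((3/2 * (euler_mascheroni - (harm m - ln (real m)))
      - inverse (real m) / 4 - (ln (real m) / real m) / 2) - g_inv (real m))
      = J_sum m - (ln (real m))\<^sup>2 / 2"
    using eventually_gt_at_top[of 0] by eventually_elim (simp add: g_inv_of_nat)
  ultimately have "(\<lambda>m. J_sum m - (ln (real m))\<^sup>2 / 2) \<longlonglongrightarrow> stieltjes_1 + (0 - l)"
    by (rule Lim_transform_eventually)
  then have "convergent (\<lambda>m. J_sum m - (ln (real m))\<^sup>2 / 2)" by (auto simp: convergent_def)
  then show ?thesis unfolding stieltjes_1_def J_sum_def by (rule convergent_LIMSEQ_iff[THEN iffD1])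
qed

lemma g_inv_of_nat_tendsto: "(\<lambda>m. g_inv (real m)) \<longlonglongrightarrow> 0"
proof -
  have "(\<lambda>m. stieltjes_1 - (J_sum m - (ln (real m))\<^sup>2 / 2)
    + (3/2 * (euler_mascheroni - (harm m - ln (real m)))
    - inverse (real m) / 4 - (ln (real m) / real m) / 2)) \<longlonglongrightarrow> stieltjes_1 - stieltjes_1 + 0"
    by (intro tendsto_add tendsto_diff tendsto_const stieltjes_1_LIMSEQ g_inv_of_nat_aux_tendsto)
  moreover have "\<forall>\<^sub>F m in sequentially. stieltjes_1 - (J_sum m - (ln (real m))\<^sup>2 / 2)
    + (3/2 * (euler_mascheroni - (harm m - ln (real m)))
    - inverse (real m) / 4 - (ln (real m) / real m) / 2) = g_inv (real m)"
    using eventually_gt_at_top[of 0] by eventually_elim (simp add: g_inv_of_nat)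
  ultimately show ?thesis by (simp add: tendsto_cong)
qed

text \<open>\<open>f_inv y\<close> decreases to \<open>0\<close> and \<open>f_inv y - 1 / y\<close>
  increases to \<open>0\<close>. By monotonicity it suffices to know the limits along the
  integers.\<close>

lemma f_inv_bounds:
  assumes "y > 0" shows "0 \<le> f_inv y" "f_inv y \<le> 1 / y"
proof -
  have ev: "\<forall>\<^sub>F m in sequentially. y \<le> real m"
    using eventually_ge_at_top[of "nat \<lceil>y\<rceil>"] by eventually_elim linarith
  show "0 \<le> f_inv y"
    using ev assms
    by (intro tendsto_upperbound[OF f_inv_of_nat_tendsto])
       (auto elim!: eventually_mono intro: f_inv_antimono)
  have "(\<lambda>m. f_inv (real m) - inverse (real m)) \<longlonglongrightarrow> 0 - 0"
    by (intro tendsto_diff f_inv_of_nat_tendsto lim_inverse_n)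
  then have "f_inv y - 1 / y \<le> 0 - 0"
    by (rule tendsto_lowerbound)
       (use ev assms f_inv_minus_mono in \<open>auto elim!: eventually_mono simp: inverse_eq_divide\<close>)
  then show "f_inv y \<le> 1 / y" by simp
qed

text \<open>On \<open>[1, \<infinity>)\<close>, \<open>g_inv y\<close> increases to \<open>0\<close>
  and \<open>g_inv y + (1 + ln y) / y\<close> decreases to \<open>0\<close>.\<close>

lemma g_inv_bounds:
  assumes "y \<ge> 1" shows "g_inv y \<le> 0" "- (1 + ln y) / y \<le> g_inv y"
proof -
  have ev: "\<forall>\<^sub>F m in sequentially. y \<le> real m"
    using eventually_ge_at_top[of "nat \<lceil>y\<rceil>"] by eventually_elim linarith
  show "g_inv y \<le> 0"
    using ev assms
    by (intro tendsto_lowerbound[OF g_inv_of_nat_tendsto])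
       (auto elim!: eventually_mono intro: g_inv_mono)
  have "(\<lambda>m. g_inv (real m) + (inverse (real m) + ln (real m) / real m)) \<longlonglongrightarrow> 0 + (0 + 0)"
    by (intro tendsto_add g_inv_of_nat_tendsto lim_inverse_n lim_ln_over_n)
  moreover have "\<forall>\<^sub>F m in sequentially. g_inv (real m) + (inverse (real m) + ln (real m) / real m)
      \<le> g_inv y + (1 + ln y) / y"
    using ev
  proof eventually_elim
    case (elim m)
    show ?case using g_inv_plus_antimono[OF assms elim] by (simp add: add_divide_distrib inverse_eq_divide)
  qed
  ultimately have "0 + (0 + 0) \<le> g_inv y + (1 + ln y) / y"
    by (rule tendsto_upperbound) auto
  then show "- (1 + ln y) / y \<le> g_inv y" unfolding minus_divide_left[symmetric] by linarith
qed

section \<open>The main term as a function of the base\<close>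

text \<open>This is the function \<open>\<phi>\<close> of the introduction, written through
  \<open>y = n / x\<close> so that the kernel bounds carry over; \<open>A_density_eq\<close>
  recovers the explicit form.\<close>

definition A_density :: "nat \<Rightarrow> real \<Rightarrow> real" where
  "A_density n x = real n ^ 3 / x\<^sup>2 * kernel (real n / x)"

definition A_main :: "nat \<Rightarrow> real \<Rightarrow> real" where
  "A_main n x = (real n)\<^sup>2 * (ln (real n) * f_inv (real n / x) + g_inv (real n / x))"

text \<open>By the chain rule the contributions of \<open>f_inv\<close> and \<open>g_inv\<close>
  carry the factors \<open>ln n\<close> and \<open>- ln (n / x)\<close>, whose sum is
  \<open>ln x\<close>.\<close>

lemma A_main_deriv:
  assumes "n > 0" "x > 0"
  shows "(A_main n has_real_derivative ln x * A_density n x) (at x)"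
proof -
  have y: "real n / x > 0" using assms by simp
  have d: "((\<lambda>x. real n / x) has_real_derivative - (real n / x\<^sup>2)) (at x)"
    using assms by (auto intro!: derivative_eq_intros simp: power2_eq_square)
  note df = DERIV_chain2[OF f_inv_deriv[OF y] d]
  note dg = DERIV_chain2[OF g_inv_deriv[OF y] d]
  have "(A_main n has_real_derivative (real n)\<^sup>2 *
     (ln (real n) * (- kernel (real n / x) * - (real n / x\<^sup>2))
      + ln (real n / x) * kernel (real n / x) * - (real n / x\<^sup>2))) (at x)"
    unfolding A_main_def[abs_def] by (intro DERIV_cmult DERIV_add df dg)
  moreover have "ln (real n / x) = ln (real n) - ln x" using assms by (simp add: ln_div)
  ultimately show ?thesis
    unfolding A_density_def by (simp add: algebra_simps eval_nat_numeral)
qed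

lemma A_density_bounds:
  assumes "n > 0" "x > 0" shows "0 \<le> A_density n x" "A_density n x \<le> real n"
proof -
  have y: "real n / x > 0" using assms by simp
  show "0 \<le> A_density n x" using kernel_bounds(1)[OF y] assms unfolding A_density_def by simp
  have "A_density n x \<le> real n ^ 3 / x\<^sup>2 * (1 / (real n / x)\<^sup>2)"
    using kernel_bounds(2)[OF y] assms unfolding A_density_def by (intro mult_left_mono) auto
  also have "\<dots> = real n" using assms by (simp add: field_simps eval_nat_numeral)
  finally show "A_density n x \<le> real n" .
qed

lemma A_density_eq:
  fixes n :: nat and x :: real
  defines "q \<equiv> real (nat \<lfloor>real n / x\<rfloor>)"
  assumes "n > 0" "x > 0"
  shows "A_density n x = (real n)\<^sup>2 / x - 2 * real n * q + q * (q + 1) * x"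
  using assms(2-) unfolding A_density_def kernel_def kernel_piece_def q_def[symmetric]
  by (simp add: field_simps eval_nat_numeral)

text \<open>The difference of the two sides factors as \<open>(q - Q) (2 y - (q + Q + 1))\<close>.
  Since \<open>Q\<close> and \<open>q\<close> are integers, \<open>Q \<noteq> q\<close> means a gap
  of at least \<open>1\<close>, which forces both factors to have the same sign.\<close>

lemma floor_maximizes_quadratic:
  fixes y :: real and Q :: nat
  assumes "y \<ge> 0"
  defines "q \<equiv> real (nat \<lfloor>y\<rfloor>)"
  shows "2 * y * real Q - real Q * (real Q + 1) \<le> 2 * y * q - q * (q + 1)"
proof -
  have q: "q \<le> y" "y < q + 1" using assms unfolding q_def by linarith+
  have "(q - real Q) * (2 * y - (q + real Q + 1)) \<ge> 0"
  proof (cases "real Q" q rule: linorder_cases)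
    case less
    then have "real Q + 1 \<le> q"
      unfolding q_def by (metis Suc_leI of_nat_Suc of_nat_le_iff of_nat_less_iff add.commute)
    with q less show ?thesis by (intro mult_nonneg_nonneg) auto
  next
    case greater
    then have "real Q \<ge> q + 1"
      unfolding q_def by (metis Suc_leI of_nat_Suc of_nat_le_iff of_nat_less_iff add.commute)
    with q greater show ?thesis by (intro mult_nonpos_nonpos) auto
  qed simp
  then show ?thesis by (simp add: algebra_simps)
qed

text \<open>
  The choice \<open>Q = \<lfloor>n / x\<rfloor>\<close> gives equality; taking for \<open>Q\<close> the floor that belongs to a nearby
  point \<open>x'\<close> makes the densities at \<open>x\<close> and \<open>x'\<close> comparable across the kinks.
\<close>

lemma A_density_le_competitor:
  fixes n Q :: nat
  assumes "n > 0" "x > 0"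
  shows "A_density n x \<le> (real n)\<^sup>2 / x - 2 * real n * real Q + real Q * (real Q + 1) * x"
proof -
  define q where "q = real (nat \<lfloor>real n / x\<rfloor>)"
  have "x * (2 * (real n / x) * real Q - real Q * (real Q + 1))
      \<le> x * (2 * (real n / x) * q - q * (q + 1))"
    unfolding q_def using assms by (intro mult_left_mono floor_maximizes_quadratic) auto
  then show ?thesis
    using A_density_eq[OF assms] assms unfolding q_def[symmetric] by (simp add: algebra_simps)
qed

lemma A_density_lipschitz:
  assumes "n > 0" "sqrt (real n) \<le> x" "x \<le> x'" "x' \<le> x + 1" "x' \<le> real n"
  shows "\<bar>A_density n x - A_density n x'\<bar> \<le> 2 * real n / x"
proof -
  have "sqrt (real n) > 0" using assms(1) by simp
  then have x: "x > 0" "x' > 0" using assms(2,3) by linarith+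
  define y y' where "y = real n / x" and "y' = real n / x'"
  have "sqrt (real n) * sqrt (real n) \<le> x * x'"
    using assms x by (intro mult_mono) auto
  then have xx: "real n \<le> x * x'" by simp
  \<comment> \<open>Beyond \<open>sqrt n\<close> a step of at most \<open>1\<close> in
    \<open>x\<close> moves \<open>n / x\<close> by at most \<open>1\<close>.\<close>
  have "(x' - x) * (real n / (x * x')) \<le> 1 * 1"
    using xx x assms by (intro mult_mono) auto
  moreover have "y - y' = (x' - x) * (real n / (x * x'))"
    unfolding y_def y'_def using x by (simp add: field_simps)
  ultimately have yy: "y - y' \<le> 1" by simp
  have y': "1 \<le> y'" "y' \<le> y" 
    using x assms unfolding y_def y'_def by (auto intro: divide_left_mono)
  define q where "q = real (nat \<lfloor>y\<rfloor>)"
  define q' where "q' = real (nat \<lfloor>y'\<rfloor>)"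
  have q: "0 \<le> q" "q \<le> y" using y' unfolding q_def by auto
  have q': "y' - 1 \<le> q'" using y' unfolding q'_def by linarith
  have n2: "(real n)\<^sup>2 / x - (real n)\<^sup>2 / x' = (x' - x) * (y * y')"
    unfolding y_def y'_def using x by (simp add: field_simps power2_eq_square)
  have a: "A_density n x = (real n)\<^sup>2 / x - 2 * real n * q + q * (q + 1) * x"
    "A_density n x' = (real n)\<^sup>2 / x' - 2 * real n * q' + q' * (q' + 1) * x'"
    using A_density_eq[OF assms(1) x(1)] A_density_eq[OF assms(1) x(2)]
    unfolding q_def q'_def y_def y'_def by simp_all
  \<comment> \<open>Each density is compared with the expression using the floor of the other point,
    so that the terms \<open>2 n q\<close> cancel in the differences below.\<close>
  have b: "A_density n x \<le> (real n)\<^sup>2 / x - 2 * real n * q' + q' * (q' + 1) * x"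
    "A_density n x' \<le> (real n)\<^sup>2 / x' - 2 * real n * q + q * (q + 1) * x'"
    unfolding q_def q'_def by (intro A_density_le_competitor assms x)+
  have "A_density n x - A_density n x' \<le> (x' - x) * (y * y') - (x' - x) * (q' * (q' + 1))"
    using a(2) b(1) n2 by (simp add: algebra_simps)
  also have "\<dots> = (x' - x) * (y * y' - q' * (q' + 1))" by (simp add: algebra_simps)
  also have "\<dots> \<le> (x' - x) * (2 * y)"
  proof (rule mult_left_mono)
    \<comment> \<open>These give
      \<open>y y' - q' (q' + 1) \<le> y' (y - y' + 1) \<le> 2 y\<close>.\<close>
    have "(y' - 1) * y' \<le> q' * (q' + 1)" using q' y' by (intro mult_mono) auto
    moreover have "y' * (y - y' + 1) \<le> y * 2" using yy y' by (intro mult_mono) auto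
    ultimately show "y * y' - q' * (q' + 1) \<le> 2 * y" by (simp add: algebra_simps)
  qed (use assms in auto)
  also have "\<dots> \<le> 1 * (2 * y)" using assms y' by (intro mult_right_mono) auto
  finally have 1: "A_density n x - A_density n x' \<le> 2 * y" by simp
  have "A_density n x' - A_density n x \<le> (x' - x) * (q * (q + 1)) - (x' - x) * (y * y')"
    using a(1) b(2) n2 by (simp add: algebra_simps)
  also have "\<dots> = (x' - x) * (q * (q + 1) - y * y')" by (simp add: algebra_simps)
  also have "\<dots> \<le> (x' - x) * (2 * y)"
  proof (rule mult_left_mono)
    have "q * (q + 1) \<le> y * (y + 1)" using q y' by (intro mult_mono) auto
    moreover have "y * (y - y' + 1) \<le> y * 2" using yy y' by (intro mult_left_mono) auto
    ultimately show "q * (q + 1) - y * y' \<le> 2 * y" by (simp add: algebra_simps)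
  qed (use assms in auto)
  also have "\<dots> \<le> 1 * (2 * y)" using assms y' by (intro mult_right_mono) auto
  finally have 2: "A_density n x' - A_density n x \<le> 2 * y" by simp
  show ?thesis using 1 2 unfolding y_def by auto
qed

text \<open>Both \<open>f_inv\<close> and \<open>g_inv\<close> are \<open>O(ln n / y)\<close> or
  smaller at \<open>y = n / x\<close>, and \<open>n\<^sup>2 / y = n x\<close>.\<close>

lemma A_main_bound:
  assumes "n > 0" "1 \<le> x" "x \<le> real n"
  shows "\<bar>A_main n x\<bar> \<le> real n * x * (2 * ln (real n) + 1)"
proof -
  define y where "y = real n / x"
  have y: "y \<ge> 1" using assms unfolding y_def by simp
  have "\<bar>f_inv y\<bar> \<le> 1 / y" using f_inv_bounds[of y] y by auto
  then have "ln (real n) * \<bar>f_inv y\<bar> \<le> ln (real n) * (1 / y)"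
    using assms by (intro mult_left_mono) auto
  moreover have "\<bar>g_inv y\<bar> \<le> (1 + ln y) / y"
    using g_inv_bounds[OF y] unfolding minus_divide_left[symmetric] by linarith
  moreover have "(1 + ln y) / y \<le> (1 + ln (real n)) / y"
    using y assms by (intro divide_right_mono) (auto simp: y_def ln_div)
  moreover have "\<bar>ln (real n) * f_inv y + g_inv y\<bar> \<le> ln (real n) * \<bar>f_inv y\<bar> + \<bar>g_inv y\<bar>"
    using assms abs_triangle_ineq[of "ln (real n) * f_inv y" "g_inv y"] by (simp add: abs_mult)
  ultimately have "\<bar>ln (real n) * f_inv y + g_inv y\<bar> \<le> (2 * ln (real n) + 1) / y"
    by (simp add: add_divide_distrib)
  then have "(real n)\<^sup>2 * \<bar>ln (real n) * f_inv y + g_inv y\<bar> \<le> (real n)\<^sup>2 * ((2 * ln (real n) + 1) / y)"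
    by (intro mult_left_mono) auto
  also have "\<dots> = real n * x * (2 * ln (real n) + 1)"
    using assms unfolding y_def by (simp add: power2_eq_square)
  finally show ?thesis unfolding A_main_def y_def[symmetric] by (simp add: abs_mult)
qed

text \<open>The derivative lies between \<open>0\<close> and \<open>n ln n\<close> on
  \<open>[1, n]\<close>. This bridges the gap between a real \<open>x\<close> and its floor.\<close>

lemma A_main_diff_le:
  assumes "n > 0" "1 \<le> x" "x \<le> x'" "x' \<le> real n"
  shows "\<bar>A_main n x' - A_main n x\<bar> \<le> (x' - x) * (real n * ln (real n))"
proof (cases "x = x'")
  case False
  then have "x < x'" using assms by simp
  then obtain z where z: "x < z" "z < x'" "A_main n x' - A_main n x = (x' - x) * (ln z * A_density n z)"
    using MVT2[of x x' "A_main n" "\<lambda>z. ln z * A_density n z"] A_main_deriv[OF assms(1)] assms by force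
  have "ln z * A_density n z \<le> ln (real n) * real n"
    using z assms A_density_bounds[of n z] by (intro mult_mono) auto
  moreover have "0 \<le> ln z * A_density n z" using z assms A_density_bounds[of n z] by simp
  ultimately show ?thesis
    unfolding z(3) using \<open>x < x'\<close> by (simp add: abs_mult mult.commute)
qed simp

text \<open>The mean value theorem yields the derivative at some \<open>z\<close> between
  \<open>x\<close> and \<open>x + 1\<close>. Replacing \<open>z\<close> by \<open>x + 1\<close> in
  the density and then in the logarithm costs at most \<open>2 sqrt n ln n\<close> each.\<close>

lemma A_main_step:
  assumes "n \<ge> 2" "sqrt (real n) \<le> x" "x + 1 \<le> real n"
  shows "\<bar>A_main n (x + 1) - A_main n x - ln (x + 1) * A_density n (x + 1)\<bar>
    \<le> 4 * sqrt (real n) * ln (real n)"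
proof -
  have n: "n > 0" using assms by simp
  have "1 \<le> sqrt (real n)" using assms by simp
  then have x: "x \<ge> 1" using assms(2) by linarith
  obtain z where z: "x < z" "z < x + 1" "A_main n (x + 1) - A_main n x = ln z * A_density n z"
    using MVT2[of x "x + 1" "A_main n" "\<lambda>z. ln z * A_density n z"] A_main_deriv[OF n] x by force
  have nz: "real n / z \<le> sqrt (real n)"
  proof -
    have "sqrt (real n) * sqrt (real n) \<le> sqrt (real n) * z"
      using z assms by (intro mult_left_mono) auto
    then show ?thesis using z x by (simp add: field_simps)
  qed
  have "ln z * \<bar>A_density n z - A_density n (x + 1)\<bar> \<le> ln (real n) * (2 * real n / z)"
    using z x assms by (intro mult_mono A_density_lipschitz n) auto
  also have "\<dots> \<le> ln (real n) * (2 * sqrt (real n))"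
    using nz assms by (intro mult_left_mono) auto
  finally have 1: "ln z * \<bar>A_density n z - A_density n (x + 1)\<bar> \<le> 2 * sqrt (real n) * ln (real n)"
    by (simp add: mult_ac)
  have "ln (x + 1) - ln z \<le> (x + 1 - z) / z" using z x by (intro ln_diff_le) auto
  also have "\<dots> \<le> 1 / z" using z x by (intro divide_right_mono) auto
  finally have "(ln (x + 1) - ln z) * A_density n (x + 1) \<le> 1 / z * real n"
    using z x A_density_bounds[OF n, of "x + 1"] by (intro mult_mono) auto
  also have "\<dots> \<le> sqrt (real n) * 1" using nz by simp
  \<comment> \<open>The logarithm is inserted by \<open>1 \<le> 2 ln n\<close>, valid from
    \<open>n = 2\<close> on.\<close>
  also have "\<dots> \<le> sqrt (real n) * (2 * ln (real n))"
  proof (rule mult_left_mono)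
    have "ln 2 \<le> ln (real n)" using assms by simp
    then show "1 \<le> 2 * ln (real n)" using ln2_ge_two_thirds by linarith
  qed auto
  finally have 2: "(ln (x + 1) - ln z) * A_density n (x + 1) \<le> 2 * sqrt (real n) * ln (real n)"
    by (simp add: mult_ac)
  have 3: "0 \<le> (ln (x + 1) - ln z) * A_density n (x + 1)"
    using z x A_density_bounds[OF n, of "x + 1"] by auto
  have "A_main n (x + 1) - A_main n x - ln (x + 1) * A_density n (x + 1)
      = ln z * (A_density n z - A_density n (x + 1)) - (ln (x + 1) - ln z) * A_density n (x + 1)"
    unfolding z(3) by (simp add: algebra_simps)
  also have "\<bar>\<dots>\<bar> \<le> \<bar>ln z * (A_density n z - A_density n (x + 1))\<bar>
      + \<bar>(ln (x + 1) - ln z) * A_density n (x + 1)\<bar>"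
    by (rule abs_triangle_ineq4)
  also have "\<dots> = ln z * \<bar>A_density n z - A_density n (x + 1)\<bar> + (ln (x + 1) - ln z) * A_density n (x + 1)"
    using 3 z x by (simp add: abs_mult[of "ln z"])
  finally show ?thesis using 1 2 by linarith
qed

section \<open>A bound for every summand\<close>

text \<open>There are at most \<open>1 + ln j / ln b\<close> digits, each at most
  \<open>b - 1\<close>. The induction strips the last digit, which lowers \<open>ln j\<close> by at
  least \<open>ln b\<close>.\<close>

lemma digit_sum_ln_le:
  assumes "b \<ge> 2" "j \<ge> 1"
  shows "real (digit_sum b j) * ln (real b) \<le> (real b - 1) * (ln (real j) + ln (real b))"
  using assms(2)
proof (induction j rule: less_induct)
  case (less j)
  have eq: "digit_sum b j = j mod b + digit_sum b (j div b)"
    using assms(1) less.prems digit_sum.simps[of b j] by simp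
  have "j mod b < b" using assms(1) by simp
  then have m: "real (j mod b) \<le> real b - 1" by linarith
  have lb: "ln (real b) \<ge> 0" using assms(1) by simp
  show ?case
  proof (cases "j < b")
    case True
    then have "digit_sum b j = j" using eq digit_sum.simps[of b 0] by simp
    moreover have "real j * ln (real b) \<le> (real b - 1) * (ln (real j) + ln (real b))"
      using m True lb less.prems by (intro mult_mono) auto
    ultimately show ?thesis by simp
  next
    case False
    then have d: "j div b \<ge> 1" "j div b < j" using assms(1)
      by (simp_all add: div_greater_zero_iff Suc_le_eq)
    have "real (j div b) \<le> real j / real b" by (rule of_nat_div_le_of_nat)
    then have "ln (real (j div b)) \<le> ln (real j / real b)" using d by simp
    also have "\<dots> = ln (real j) - ln (real b)" using assms less.prems by (simp add: ln_div)
    finally have "(real b - 1) * (ln (real (j div b)) + ln (real b)) \<le> (real b - 1) * ln (real j)"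
      using assms(1) by (intro mult_left_mono) auto
    moreover have "real (j mod b) * ln (real b) \<le> (real b - 1) * ln (real b)"
      using m lb by (rule mult_right_mono)
    ultimately show ?thesis using less.IH[OF d(2) d(1)] unfolding eq by (simp add: algebra_simps)
  qed
qed

definition A_term :: "nat \<Rightarrow> nat \<Rightarrow> real" where
  "A_term n b = 2 / (real b - 1) * real (S_sum b n) * ln (real b)"

text \<open>For \<open>j < n\<close> and \<open>b \<le> n\<close> the digit bound is at most
  \<open>(b - 1) * 2 ln n\<close>, and \<open>b - 1\<close> cancels against the weight
  \<open>2 / (b - 1)\<close>.\<close>

lemma A_term_bounds:
  assumes "2 \<le> b" "b \<le> n"
  shows "0 \<le> A_term n b" "A_term n b \<le> 4 * real n * ln (real n)"
proof -
  show "0 \<le> A_term n b" using assms unfolding A_term_def by simp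
  have "real (S_sum b n) * ln (real b) = (\<Sum>j=1..<n. real (digit_sum b j) * ln (real b))"
    unfolding S_sum_def by (simp add: sum_distrib_right)
  also have "\<dots> \<le> (\<Sum>j=1..<n. (real b - 1) * (2 * ln (real n)))"
  proof (rule sum_mono)
    fix j assume j: "j \<in> {1..<n}"
    have "real (digit_sum b j) * ln (real b) \<le> (real b - 1) * (ln (real j) + ln (real b))"
      using digit_sum_ln_le assms j by simp
    also have "\<dots> \<le> (real b - 1) * (2 * ln (real n))"
    proof (rule mult_left_mono)
      have "ln (real j) \<le> ln (real n)" "ln (real b) \<le> ln (real n)" using j assms by simp_all
      then show "ln (real j) + ln (real b) \<le> 2 * ln (real n)" by linarith
    qed (use assms in auto)
    finally show "real (digit_sum b j) * ln (real b) \<le> (real b - 1) * (2 * ln (real n))" .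
  qed
  also have "\<dots> = real (n - 1) * ((real b - 1) * (2 * ln (real n)))" by simp
  also have "\<dots> \<le> real n * ((real b - 1) * (2 * ln (real n)))"
    using assms by (intro mult_right_mono) auto
  finally have "2 / (real b - 1) * (real (S_sum b n) * ln (real b))
      \<le> 2 / (real b - 1) * (real n * ((real b - 1) * (2 * ln (real n))))"
    using assms by (intro mult_left_mono) auto
  also have "\<dots> = 4 * real n * ln (real n)" using assms by (simp add: field_simps)
  finally show "A_term n b \<le> 4 * real n * ln (real n)" unfolding A_term_def by simp
qed

lemma sum_A_term_le:
  assumes "M \<le> n"
  shows "\<bar>\<Sum>b=2..M. A_term n b\<bar> \<le> real M * (4 * real n * ln (real n))"
proof -
  have "\<bar>\<Sum>b=2..M. A_term n b\<bar> \<le> (\<Sum>b=2..M. \<bar>A_term n b\<bar>)" by (rule sum_abs)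
  also have "\<dots> \<le> (\<Sum>b=2..M. 4 * real n * ln (real n))"
    using assms A_term_bounds[of _ n] by (intro sum_mono) auto
  also have "\<dots> = real (M - 1) * (4 * real n * ln (real n))" by simp
  also have "\<dots> \<le> real M * (4 * real n * ln (real n))"
    by (cases "n = 0") (auto intro!: mult_right_mono)
  finally show ?thesis .
qed

section \<open>Bases with at most two digits\<close>

text \<open>With \<open>q = n div b\<close>, passing to \<open>n + 1\<close> adds \<open>q\<close>
  on both sides. If \<open>b\<close> divides \<open>n + 1\<close>, the quotient also rises to
  \<open>q + 1\<close>, which changes the right side by
  \<open>n + 1 - b (q + 1) = 0\<close>.\<close>

lemma sum_div_eq:
  assumes "b > 0"
  shows "(\<Sum>j<n. real (j div b)) =
    real n * real (n div b) - real b * real (n div b) * (real (n div b) + 1) / 2"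
proof (induction n)
  case (Suc n)
  show ?case
  proof (cases "Suc n mod b = 0")
    case True
    then have d: "Suc n div b = Suc (n div b)" using assms by (simp add: div_Suc)
    have "Suc n = b * Suc (n div b)" using True d by (metis dvd_imp_mod_0 dvd_mult_div_cancel mod_0_imp_dvd)
    then have "real (Suc n) = real b * (real (n div b) + 1)" by (metis of_nat_Suc of_nat_mult add.commute)
    then have e: "real n = real b * (real (n div b) + 1) - 1" by simp
    show ?thesis using Suc unfolding sum.lessThan_Suc d of_nat_Suc e
      by (simp add: algebra_simps add_divide_distrib)
  next
    case False
    then have "Suc n div b = n div b" by (simp add: div_Suc)
    then show ?thesis using Suc by (simp add: algebra_simps)
  qed
qed simp

lemma digit_sum_two_digits:
  assumes "b \<ge> 2" "j < b\<^sup>2"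
  shows "real (digit_sum b j) = real j - (real b - 1) * real (j div b)"
proof -
  have "j div b < b" using assms by (simp add: less_mult_imp_div_less power2_eq_square)
  then have e: "digit_sum b (j div b) = j div b"
    using assms(1) digit_sum.simps[of b "j div b"] digit_sum.simps[of b 0] by simp
  have "digit_sum b j = j mod b + j div b"
    using assms(1) digit_sum.simps[of b j] e by (cases "j = 0") auto
  moreover have "real j = real b * real (j div b) + real (j mod b)"
    by (metis mult_div_mod_eq of_nat_add of_nat_mult)
  ultimately show ?thesis by (simp add: algebra_simps)
qed

lemma S_sum_two_digits:
  assumes "b \<ge> 2" "n \<le> b\<^sup>2"
  shows "real (S_sum b n) = real n * (real n - 1) / 2 - (real b - 1) *
    (real n * real (n div b) - real b * real (n div b) * (real (n div b) + 1) / 2)"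
proof -
  have "digit_sum b 0 = 0" by (simp add: digit_sum.simps)
  \<comment> \<open>The sum stops at \<open>n - 1\<close>, so \<open>n \<le> b\<^sup>2\<close>
    already keeps every index below \<open>b\<^sup>2\<close>.\<close>
  then have "real (S_sum b n) = (\<Sum>j<n. real (digit_sum b j))"
    unfolding S_sum_def of_nat_sum by (intro sum.mono_neutral_left) (auto simp: not_le)
  also have "\<dots> = (\<Sum>j<n. real j - (real b - 1) * real (j div b))"
    using assms by (intro sum.cong digit_sum_two_digits) auto
  also have "\<dots> = (\<Sum>j<n. real j) - (real b - 1) * (\<Sum>j<n. real (j div b))"
    by (simp add: sum_subtractf sum_distrib_left)
  also have "(\<Sum>j<n. real j) = real n * (real n - 1) / 2"
    by (induction n) (simp_all add: field_simps)
  also have "(\<Sum>j<n. real (j div b)) = real n * real (n div b)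
      - real b * real (n div b) * (real (n div b) + 1) / 2"
    using assms by (intro sum_div_eq) simp
  finally show ?thesis .
qed

text \<open>The terms with \<open>q\<close> agree exactly. What remains is \<open>n (n - 1) / (b -
  1) - n\<^sup>2 / b = n (n - b) / (b (b - 1))\<close>, written with a difference of reciprocals so
  that it telescopes over \<open>b\<close>.\<close>

lemma A_term_approx:
  assumes "b \<ge> 2" "n \<le> b\<^sup>2" "b \<le> n"
  shows "\<bar>A_term n b - ln (real b) * A_density n (real b)\<bar>
    \<le> (real n)\<^sup>2 * ln (real n) * (1 / (real b - 1) - 1 / real b)"
proof -
  have n: "n > 0" "real b > 0" using assms by auto
  define q where "q = real (n div b)"
  have "nat \<lfloor>real n / real b\<rfloor> = n div b" by (simp add: floor_divide_of_nat_eq)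
  then have p: "A_density n (real b) = (real n)\<^sup>2 / real b - 2 * real n * q + q * (q + 1) * real b"
    using A_density_eq[OF n] unfolding q_def by simp
  have S: "real (S_sum b n) = real n * (real n - 1) / 2 - (real b - 1) *
      (real n * q - real b * q * (q + 1) / 2)"
    using S_sum_two_digits[OF assms(1,2)] unfolding q_def .
  define E where "E = ln (real b) * (real n * (real n - real b) * (1 / (real b - 1) - 1 / real b))"
  have "2 / (real b - 1) * real (S_sum b n) - A_density n (real b)
      = real n * (real n - real b) * (1 / (real b - 1) - 1 / real b)"
    unfolding S p using assms by (simp add: field_simps power2_eq_square)
  then have "A_term n b - ln (real b) * A_density n (real b) = E"
    unfolding A_term_def E_def by (metis mult.commute right_diff_distrib)
  moreover have "0 \<le> E"
    unfolding E_def using assms by (intro mult_nonneg_nonneg) (auto intro!: divide_left_mono)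
  moreover have "E \<le> ln (real n) * (real n * real n * (1 / (real b - 1) - 1 / real b))"
    unfolding E_def using assms
    by (intro mult_mono mult_nonneg_nonneg) (auto intro!: divide_left_mono)
  ultimately show ?thesis by (simp add: power2_eq_square mult_ac)
qed

section \<open>Summation over the bases\<close>

lemma sum_A_term_approx:
  assumes "n \<ge> 2" "sqrt (real n) \<le> real B" "B \<le> N" "N \<le> n"
  shows "\<bar>(\<Sum>b=Suc B..N. A_term n b) - (A_main n (real N) - A_main n (real B))\<bar>
    \<le> real (N - B) * (4 * sqrt (real n) * ln (real n))
      + (real n)\<^sup>2 * ln (real n) * (1 / real B - 1 / real N)"
  using assms(3,4)
proof (induction N rule: dec_induct)
  case (step N)
  have "1 \<le> sqrt (real n)" using assms by simp
  then have B: "real B \<ge> 1" using assms(2) by linarith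
  have sq: "sqrt (real n) \<le> real N" using assms(2) step.hyps by linarith
  then have "(sqrt (real n))\<^sup>2 \<le> (real (Suc N))\<^sup>2" by (intro power_mono) auto
  then have "real n \<le> real ((Suc N)\<^sup>2)" by simp
  then have "n \<le> (Suc N)\<^sup>2" by (simp only: of_nat_le_iff)
  moreover have "Suc N \<ge> 2" using B step.hyps by linarith
  ultimately have 1: "\<bar>A_term n (Suc N) - ln (real (Suc N)) * A_density n (real (Suc N))\<bar>
      \<le> (real n)\<^sup>2 * ln (real n) * (1 / real N - 1 / real (Suc N))"
    using A_term_approx[of "Suc N" n] step.prems by simp
  have 2: "\<bar>A_main n (real (Suc N)) - A_main n (real N) - ln (real (Suc N)) * A_density n (real (Suc N))\<bar>
      \<le> 4 * sqrt (real n) * ln (real n)"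
    using A_main_step[OF assms(1) sq] step.prems by (simp add: add.commute)
  have 3: "(\<Sum>b=Suc B..Suc N. A_term n b) = (\<Sum>b=Suc B..N. A_term n b) + A_term n (Suc N)"
    using step.hyps by simp
  have 4: "real (Suc N - B) * (4 * sqrt (real n) * ln (real n))
      = real (N - B) * (4 * sqrt (real n) * ln (real n)) + 4 * sqrt (real n) * ln (real n)"
    using step.hyps by (simp add: Suc_diff_le algebra_simps)
  have 5: "(real n)\<^sup>2 * ln (real n) * (1 / real B - 1 / real (Suc N))
      = (real n)\<^sup>2 * ln (real n) * (1 / real B - 1 / real N)
      + (real n)\<^sup>2 * ln (real n) * (1 / real N - 1 / real (Suc N))"
    by (simp add: algebra_simps)
  show ?case using 1 2 step.IH step.prems unfolding 3 4 5 by linarith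
qed simp

lemma A_bar_eq: "A_bar n x = (\<Sum>b=2..nat \<lfloor>x\<rfloor>. A_term n b)"
  by (simp add: A_bar_def A_term_def)

lemma A_main_eq:
  assumes "n > 0" "\<alpha> > 0"
  shows "f_A_bar \<alpha> * (real n)\<^sup>2 * ln (real n) + g_A_bar \<alpha> * (real n)\<^sup>2 = A_main n (\<alpha> * real n)"
  using assms by (simp add: A_main_def f_A_bar_eq g_A_bar_eq algebra_simps)

text \<open>With \<open>R = n sqrt n ln n\<close>, the constant is
  \<open>22 = 8 + 8 + 5 + 1\<close>: the bases up to \<open>B\<close>, the main term at
  \<open>B\<close>, the sum from \<open>B\<close> to \<open>N\<close>, and the last piece from
  \<open>N\<close> to \<open>x\<close>.\<close>

lemma A_bar_approx:
  assumes n: "n \<ge> 2" and x: "sqrt (real n) \<le> x" "x \<le> real n"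
  shows "\<bar>A_bar n x - A_main n x\<bar> \<le> 22 * (real n * sqrt (real n) * ln (real n))"
proof -
  define R where "R = real n * sqrt (real n) * ln (real n)"
  define B where "B = nat \<lceil>sqrt (real n)\<rceil>"
  define N where "N = nat \<lfloor>x\<rfloor>"
  have s1: "1 \<le> sqrt (real n)" using n by simp
  have sn: "sqrt (real n) * sqrt (real n) = real n" by simp
  have B: "sqrt (real n) \<le> real B" "real B \<le> 2 * sqrt (real n)"
    using s1 unfolding B_def by linarith+
  have "sqrt (real n) \<le> real n" using mult_left_mono[OF s1, of "sqrt (real n)"] sn by simp
  then have Bn: "B \<le> n" unfolding B_def by (simp add: ceiling_le_iff nat_le_iff)
  have x1: "1 \<le> x" using s1 x by linarith
  have N: "real N \<le> x" "x < real N + 1" using x1 unfolding N_def by linarith+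
  have Nn: "N \<le> n" using N x by linarith
  have "ln 2 \<le> ln (real n)" using n by simp
  then have ln1: "1 \<le> 2 * ln (real n)" using ln2_ge_two_thirds by linarith
  have small: "\<bar>\<Sum>b=2..M. A_term n b\<bar> \<le> 8 * R" if "M \<le> B" for M
  proof -
    have "\<bar>\<Sum>b=2..M. A_term n b\<bar> \<le> real M * (4 * real n * ln (real n))"
      using that Bn by (intro sum_A_term_le) auto
    also have "\<dots> \<le> (2 * sqrt (real n)) * (4 * real n * ln (real n))"
      using that B n by (intro mult_right_mono) auto
    finally show ?thesis unfolding R_def by (simp add: mult_ac)
  qed
  have main: "\<bar>A_main n z\<bar> \<le> 8 * R" if "1 \<le> z" "z \<le> real B" for z
  proof -
    have "\<bar>A_main n z\<bar> \<le> real n * z * (2 * ln (real n) + 1)"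
      using that Bn n by (intro A_main_bound) auto
    also have "\<dots> \<le> real n * (2 * sqrt (real n)) * (4 * ln (real n))"
      using that B n ln1 by (intro mult_mono mult_left_mono) auto
    finally show ?thesis unfolding R_def by (simp add: mult_ac)
  qed
  have R: "R \<ge> 0" using n unfolding R_def by simp
  show ?thesis
  proof (cases "B \<le> N")
    case False
    \<comment> \<open>No base lies beyond \<open>B\<close>, so sum and main term are each at most
      \<open>8 R\<close>.\<close>
    then have "x \<le> real B" using N by linarith
    then show ?thesis
      using small[of N] main[of x] False x1 R
      unfolding A_bar_eq N_def[symmetric] R_def[symmetric] by linarith
  next
    case True
    have B1: "1 \<le> real B" using B s1 by linarith
    have "(\<Sum>b=2..N. A_term n b) = (\<Sum>b=2..B. A_term n b) + (\<Sum>b=Suc B..N. A_term n b)"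
      using True B1 sum.ub_add_nat[of 2 B "A_term n" "N - B"] by simp
    \<comment> \<open>At most \<open>n\<close> steps give \<open>4 R\<close>; the telescoped error
      is at most \<open>n\<^sup>2 ln n / sqrt n = R\<close>.\<close>
    moreover have "\<bar>(\<Sum>b=Suc B..N. A_term n b) - (A_main n (real N) - A_main n (real B))\<bar> \<le> 5 * R"
    proof -
      have "real (N - B) * (4 * sqrt (real n) * ln (real n)) \<le> real n * (4 * sqrt (real n) * ln (real n))"
        using Nn n by (intro mult_right_mono) auto
      moreover have "(real n)\<^sup>2 * ln (real n) * (1 / real B - 1 / real N)
          \<le> (real n)\<^sup>2 * ln (real n) * (1 / sqrt (real n))"
      proof (rule mult_left_mono)
        have "1 / real B \<le> 1 / sqrt (real n)" using B s1 B1 by (intro divide_left_mono mult_pos_pos) linarith+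
        moreover have "0 \<le> 1 / real N" by simp
        ultimately show "1 / real B - 1 / real N \<le> 1 / sqrt (real n)" by linarith
      qed (use n in auto)
      moreover have "(real n)\<^sup>2 * ln (real n) * (1 / sqrt (real n))
          = real n * (real n / sqrt (real n)) * ln (real n)"
        by (simp add: power2_eq_square)
      then have "(real n)\<^sup>2 * ln (real n) * (1 / sqrt (real n)) = R"
        unfolding R_def by (simp add: real_div_sqrt)
      ultimately show ?thesis
        using sum_A_term_approx[OF n B(1) True Nn] unfolding R_def by (simp add: mult_ac)
    qed
    moreover have "\<bar>A_main n x - A_main n (real N)\<bar> \<le> R"
    proof -
      have "\<bar>A_main n x - A_main n (real N)\<bar> \<le> (x - real N) * (real n * ln (real n))"
        using n N x B1 True by (intro A_main_diff_le) auto
      also have "\<dots> \<le> sqrt (real n) * (real n * ln (real n))"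
      proof (rule mult_right_mono)
        show "x - real N \<le> sqrt (real n)" using N s1 by linarith
      qed (use n in auto)
      finally show ?thesis unfolding R_def by (simp add: mult_ac)
    qed
    ultimately show ?thesis
      using small[of B] main[of "real B"] B1
      unfolding A_bar_eq N_def[symmetric] R_def[symmetric] by linarith
  qed
qed

section \<open>The two ranges of \<open>\<alpha>\<close>\<close>

lemma powr_three_halves: "(x::real) > 0 \<Longrightarrow> x powr (3/2) = x * sqrt x"
  using powr_add[of x 1 "1/2"] by (simp add: powr_half_sqrt)

theorem theorem3p4:
  shows "(\<exists>C::real. \<forall>n::nat. \<forall>\<alpha>::real. n \<ge> 2 \<longrightarrow> \<alpha> \<in> {1 / sqrt (real n)..1} \<longrightarrow>
            \<bar>A_bar n (\<alpha> * real n)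
              - (f_A_bar \<alpha> * (real n)\<^sup>2 * ln (real n) + g_A_bar \<alpha> * (real n)\<^sup>2)\<bar>
            \<le> C * (real n powr (3/2) * ln (real n)))
       \<and> (\<exists>C::real. \<forall>n::nat. \<forall>\<alpha>::real. n \<ge> 2 \<longrightarrow> \<alpha> \<in> {1 / real n..1 / sqrt (real n)} \<longrightarrow>
            \<bar>A_bar n (\<alpha> * real n)\<bar> \<le> C * (real n powr (3/2) * ln (real n)))"
proof (intro conjI exI allI impI)
  fix n :: nat and \<alpha> :: real
  assume n: "2 \<le> n" and \<alpha>: "\<alpha> \<in> {1 / sqrt (real n)..1}"
  have s: "sqrt (real n) > 0" using n by simp
  then have "0 < 1 / sqrt (real n)" by simp
  then have a: "\<alpha> > 0" using \<alpha> by (meson atLeastAtMost_iff less_le_trans)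
  have "1 / sqrt (real n) * real n \<le> \<alpha> * real n" using \<alpha> by (intro mult_right_mono) auto
  then have "sqrt (real n) \<le> \<alpha> * real n" by (simp add: real_div_sqrt)
  moreover have "\<alpha> * real n \<le> real n" using \<alpha> by (simp add: mult_left_le_one_le a less_imp_le)
  ultimately show "\<bar>A_bar n (\<alpha> * real n)
      - (f_A_bar \<alpha> * (real n)\<^sup>2 * ln (real n) + g_A_bar \<alpha> * (real n)\<^sup>2)\<bar>
      \<le> 22 * (real n powr (3/2) * ln (real n))"
    using A_bar_approx[OF n] A_main_eq[of n \<alpha>] n a by (simp add: powr_three_halves)
next
  fix n :: nat and \<alpha> :: real
  assume n: "2 \<le> n" and \<alpha>: "\<alpha> \<in> {1 / real n..1 / sqrt (real n)}"
  define N where "N = nat \<lfloor>\<alpha> * real n\<rfloor>"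
  have s: "1 \<le> sqrt (real n)" using n by simp
  \<comment> \<open>In this range there are at most \<open>sqrt n\<close> bases, so the bound for
    single summands suffices.\<close>
  have "\<alpha> * real n \<le> 1 / sqrt (real n) * real n" using \<alpha> by (intro mult_right_mono) auto
  then have x: "\<alpha> * real n \<le> sqrt (real n)" by (simp add: real_div_sqrt)
  then have N: "real N \<le> sqrt (real n)" using s unfolding N_def by linarith
  have "sqrt (real n) \<le> real n" using mult_left_mono[OF s, of "sqrt (real n)"] by simp
  then have "N \<le> n" using N by linarith
  then have "\<bar>A_bar n (\<alpha> * real n)\<bar> \<le> real N * (4 * real n * ln (real n))"
    unfolding A_bar_eq N_def by (rule sum_A_term_le)
  also have "\<dots> \<le> sqrt (real n) * (4 * real n * ln (real n))"
    using N n by (intro mult_right_mono) auto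
  also have "\<dots> = 4 * (real n powr (3/2) * ln (real n))" using n by (simp add: powr_three_halves)
  finally show "\<bar>A_bar n (\<alpha> * real n)\<bar> \<le> 4 * (real n powr (3/2) * ln (real n))" .
qed

end
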